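(* Let $n\ge 2$, let $0\le \alpha_1<\alpha_2<\dots<\alpha_n$ be integers, and let $x_1,\dots,x_n$ be positive integers. For $0\le k\le n$ put $p_k=\sum_{i=1}^k x_i$ and $q_k=\sum_{i=1}^k \alpha_i x_i$ (so $p_0=q_0=0$). Then $$\sum_{i=1}^k \alpha_i x_i \;\ge\; \frac{\left(\sum_{i=1}^k x_i\right)\left(\sum_{i=1}^k x_i-1\right)}{2}\quad\text{for all } 1\le k\le n,\ \text{with equality for } k=n,$$ holds if and only if for every $k$ with $1\le k\le n$, $$q_{k-1}-\frac{p_{k-1}(p_{k-1}-1)}{2}\ge 0\quad\text{and}\quad 1\le x_k\le \frac{\bigl(2(\alpha_k-p_{k-1})+1\bigr)+\sqrt{\bigl(2(\alpha_k-p_{k-1})+1\bigr)^2+8\bigl(q_{k-1}-p_{k-1}(p_{k-1}-1)/2\bigr)}}{2},$$ with equality in the right-hand inequality when $k=n$.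
   Context: Here $\{\alpha_1,\dots,\alpha_n\}$ plays the role of a score (degree) set of a tournament and $x_i$ is the number of times the score $\alpha_i$ occurs in a score sequence. *)

theory Defs
  imports Complex_Main
begin

definition psum :: "(nat \<Rightarrow> int) \<Rightarrow> nat \<Rightarrow> int" where
  "psum x k = (\<Sum>i=1..k. x i)"

definition qsum :: "(nat \<Rightarrow> int) \<Rightarrow> (nat \<Rightarrow> int) \<Rightarrow> nat \<Rightarrow> int" where
  "qsum \<alpha> x k = (\<Sum>i=1..k. \<alpha> i * x i)"

definition excess :: "(nat \<Rightarrow> int) \<Rightarrow> (nat \<Rightarrow> int) \<Rightarrow> nat \<Rightarrow> real" where
  "excess \<alpha> x k =
     real_of_int (qsum \<alpha> x k) - real_of_int (psum x k) * (real_of_int (psum x k) - 1) / 2"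

(* Intended for k \<ge> 1.  The radicand is nonnegative whenever excess \<alpha> x (k - 1) is;
   otherwise sqrt may be applied to a negative number, where it is defined as an odd function. *)
definition xbound :: "(nat \<Rightarrow> int) \<Rightarrow> (nat \<Rightarrow> int) \<Rightarrow> nat \<Rightarrow> real" where
  "xbound \<alpha> x k =
     (let b = 2 * (real_of_int (\<alpha> k) - real_of_int (psum x (k - 1))) + 1
      in (b + sqrt (b\<^sup>2 + 8 * excess \<alpha> x (k - 1))) / 2)"

end

theory Submission
  imports Defs
begin

text \<open>
  With b = 2 (\<alpha>_k - p_(k-1)) + 1, the excesses satisfy 2 E_k = 2 E_(k-1) + b x_k - x_k^2.
  If E_(k-1) \<ge> 0, this quadratic in x_k has one nonpositive root, and its other root is the bound in
  the theorem; hence for x_k > 0 the sign of E_k is the sign of (bound - x_k).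
\<close>

text \<open>The roots in \<open>t\<close> are \<open>(b - s) / 2\<close> and
  \<open>(b + s) / 2\<close>, where \<open>s\<close> is the square root. As \<open>c \<ge> 0\<close>
  gives \<open>b \<le> s\<close>, the smaller root is nonpositive, so its linear factor is positive
  at \<open>t > 0\<close>.\<close>

lemma quadratic_factor_pos_root:
  fixes b c t :: real
  assumes "c \<ge> 0" and "t > 0"
  obtains d where "d > 0" and "2 * c + b * t - t\<^sup>2 = d * ((b + sqrt (b\<^sup>2 + 8 * c)) / 2 - t)"
proof
  let ?s = "sqrt (b\<^sup>2 + 8 * c)"
  have "b \<le> ?s"
    using assms(1) by (intro real_le_rsqrt) simp
  \<comment> \<open>This witness for \<open>d\<close> is the distance from \<open>t\<close> to the
    smaller root.\<close>
  then show "t + (?s - b) / 2 > 0"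
    using assms(2) by (intro add_pos_nonneg) simp_all
  have "?s\<^sup>2 = b\<^sup>2 + 8 * c"
    using assms(1) by simp
  then show "2 * c + b * t - t\<^sup>2 = (t + (?s - b) / 2) * ((b + ?s) / 2 - t)"
    by (simp add: field_simps power2_eq_square)
qed

lemma excess_0 [simp]: "excess \<alpha> x 0 = 0"
  by (simp add: excess_def psum_def qsum_def)

text \<open>With p = \<open>psum x k\<close> and y = \<open>x (Suc k)\<close>, expand (p + y)(p + y
  - 1) = p(p - 1) + 2py + y^2 - y. Doubling clears the denominator and matches the quadratic
  above.\<close>

lemma excess_Suc:
  "2 * excess \<alpha> x (Suc k) = 2 * excess \<alpha> x k
     + (2 * (real_of_int (\<alpha> (Suc k)) - real_of_int (psum x k)) + 1) * real_of_int (x (Suc k))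
     - (real_of_int (x (Suc k)))\<^sup>2"
  by (simp add: excess_def psum_def qsum_def field_simps power2_eq_square)

text \<open>The excess at \<open>k\<close> is a positive multiple of
  \<open>xbound \<alpha> x k - x k\<close>, so both its sign and its vanishing carry over.\<close>

lemma
  assumes "k \<ge> 1" and "excess \<alpha> x (k - 1) \<ge> 0" and "x k > 0"
  shows excess_nonneg_iff_le_xbound: "excess \<alpha> x k \<ge> 0 \<longleftrightarrow> real_of_int (x k) \<le> xbound \<alpha> x k"
    and excess_eq_0_iff_eq_xbound: "excess \<alpha> x k = 0 \<longleftrightarrow> real_of_int (x k) = xbound \<alpha> x k"
proof -
  have "2 * excess \<alpha> x k = 2 * excess \<alpha> x (k - 1)
      + (2 * (real_of_int (\<alpha> k) - real_of_int (psum x (k - 1))) + 1) * real_of_int (x k)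
      - (real_of_int (x k))\<^sup>2"
    using excess_Suc[of \<alpha> x "k - 1"] assms(1) by simp
  moreover obtain d where "d > 0" and
    "2 * excess \<alpha> x (k - 1)
      + (2 * (real_of_int (\<alpha> k) - real_of_int (psum x (k - 1))) + 1) * real_of_int (x k)
      - (real_of_int (x k))\<^sup>2 = d * (xbound \<alpha> x k - real_of_int (x k))"
    unfolding xbound_def Let_def
    using quadratic_factor_pos_root[OF assms(2), of "real_of_int (x k)"] assms(3) by auto
  ultimately have eq: "excess \<alpha> x k = d / 2 * (xbound \<alpha> x k - real_of_int (x k))"
    by simp
  show "excess \<alpha> x k \<ge> 0 \<longleftrightarrow> real_of_int (x k) \<le> xbound \<alpha> x k"
    unfolding eq using \<open>d > 0\<close> by (simp add: zero_le_mult_iff)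
  show "excess \<alpha> x k = 0 \<longleftrightarrow> real_of_int (x k) = xbound \<alpha> x k"
    unfolding eq using \<open>d > 0\<close> by auto
qed

theorem theorem2p3:
  fixes n :: nat and \<alpha> x :: "nat \<Rightarrow> int"
  assumes "n \<ge> 2"
    and "0 \<le> \<alpha> 1"
    and "strict_mono_on {1..n} \<alpha>"
    and "\<forall>i\<in>{1..n}. 0 < x i"
  shows "((\<forall>k\<in>{1..n}.
              real_of_int (\<Sum>i=1..k. \<alpha> i * x i)
                \<ge> real_of_int (\<Sum>i=1..k. x i) * (real_of_int (\<Sum>i=1..k. x i) - 1) / 2)
          \<and> real_of_int (\<Sum>i=1..n. \<alpha> i * x i)
                = real_of_int (\<Sum>i=1..n. x i) * (real_of_int (\<Sum>i=1..n. x i) - 1) / 2)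
     \<longleftrightarrow> ((\<forall>k\<in>{1..n}.
              excess \<alpha> x (k - 1) \<ge> 0
              \<and> 1 \<le> x k \<and> real_of_int (x k) \<le> xbound \<alpha> x k)
          \<and> real_of_int (x n) = xbound \<alpha> x n)"
proof -
  have lhs: "real_of_int (\<Sum>i=1..k. \<alpha> i * x i)
      - real_of_int (\<Sum>i=1..k. x i) * (real_of_int (\<Sum>i=1..k. x i) - 1) / 2 = excess \<alpha> x k" for k
    by (simp add: excess_def psum_def qsum_def)
  have ge: "real_of_int (\<Sum>i=1..k. \<alpha> i * x i)
        \<ge> real_of_int (\<Sum>i=1..k. x i) * (real_of_int (\<Sum>i=1..k. x i) - 1) / 2
      \<longleftrightarrow> excess \<alpha> x k \<ge> 0"
    and eq: "real_of_int (\<Sum>i=1..k. \<alpha> i * x i)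
        = real_of_int (\<Sum>i=1..k. x i) * (real_of_int (\<Sum>i=1..k. x i) - 1) / 2
      \<longleftrightarrow> excess \<alpha> x k = 0" for k
    using lhs[of k] by linarith+
  have n: "n \<in> {1..n}"
    using assms(1) by simp
  have le_iff: "excess \<alpha> x k \<ge> 0 \<longleftrightarrow> real_of_int (x k) \<le> xbound \<alpha> x k"
    and eq_iff: "excess \<alpha> x k = 0 \<longleftrightarrow> real_of_int (x k) = xbound \<alpha> x k"
    if "k \<in> {1..n}" "excess \<alpha> x (k - 1) \<ge> 0" for k
    using excess_nonneg_iff_le_xbound[of k \<alpha> x] excess_eq_0_iff_eq_xbound[of k \<alpha> x] that assms(4)
    by auto
  have x_ge_1: "1 \<le> x k" if "k \<in> {1..n}" for k
    using assms(4) that by fastforce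
  \<comment> \<open>The bounds refer to indices 0 to n - 1, the inequalities to 1 to n; the extra
    index 0 is covered by \<open>excess_0\<close>.\<close>
  have prev: "excess \<alpha> x (k - 1) \<ge> 0"
    if "\<forall>k\<in>{1..n}. excess \<alpha> x k \<ge> 0" and "k \<in> {1..n}" for k
  proof (cases "k = 1")
    case False
    with that(2) have "k - 1 \<in> {1..n}"
      by auto
    with that(1) show ?thesis
      by blast
  qed simp
  \<comment> \<open>Left to right, \<open>prev\<close> supplies the premise of \<open>le_iff\<close>
    and \<open>eq_iff\<close>; right to left, that premise is among the assumed conditions. Each
    \<open>k\<close> is thus treated separately, without induction.\<close>
  show ?thesis
    unfolding ge eq using le_iff eq_iff x_ge_1 prev n by blast
qed

end
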